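(* Let $A\in\mathbb{R}^{n\times n}$, $B\in\mathbb{R}^{n\times m}$ with $(A,B)$ controllable, and let $u_d(0),\dots,u_d(T-1)\in\mathbb{R}^m$ and $x_d(0),\dots,x_d(T)\in\mathbb{R}^n$ be data satisfying $x_d(k+1)=Ax_d(k)+Bu_d(k)$ for $k=0,\dots,T-1$. Let $U_{0,1,T}$, $X_{0,T}$, $X_{1,T}$ be the data matrices defined in the context, and suppose that $$\operatorname{rank}\begin{bmatrix}U_{0,1,T}\\ X_{0,T}\end{bmatrix}=n+m .$$ Then the system $x(k+1)=Ax(k)+Bu(k)$ has the equivalent representation $$x(k+1)=X_{1,T}\begin{bmatrix}U_{0,1,T}\\ X_{0,T}\end{bmatrix}^{\dagger}\begin{bmatrix}u(k)\\ x(k)\end{bmatrix},$$ i.e. for all $u\in\mathbb{R}^m$, $x\in\mathbb{R}^n$, $$Ax+Bu=X_{1,T}\begin{bmatrix}U_{0,1,T}\\ X_{0,T}\end{bmatrix}^{\dagger}\begin{bmatrix}u\\ x\end{bmatrix}.$$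
   Context: Data matrices: $U_{0,1,T}=[u_d(0)\ u_d(1)\ \cdots\ u_d(T-1)]\in\mathbb{R}^{m\times T}$, $X_{0,T}=[x_d(0)\ x_d(1)\ \cdots\ x_d(T-1)]\in\mathbb{R}^{n\times T}$, $X_{1,T}=[x_d(1)\ x_d(2)\ \cdots\ x_d(T)]\in\mathbb{R}^{n\times T}$. For a full-row-rank matrix $S$, $S^\dagger$ denotes its right inverse (Moore–Penrose), $S^\dagger=S^\top(SS^\top)^{-1}$. *)

theory Defs
  imports
    "Jordan_Normal_Form.DL_Rank"
    "Jordan_Normal_Form.Gauss_Jordan_Elimination"
begin

text \<open>
  Controllability of the discrete-time pair \<open>(A, B)\<close>: every state can be steered to every other
  state in finitely many steps. The input sequence \<open>u\<close> and the state sequence \<open>x\<close> only matter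
  up to the final time \<open>N\<close>.
\<close>

definition controllable :: "real mat \<Rightarrow> real mat \<Rightarrow> bool" where
  "controllable A B \<longleftrightarrow>
    (\<forall>x0 \<in> carrier_vec (dim_row A). \<forall>x1 \<in> carrier_vec (dim_row A).
      \<exists>N u x. (\<forall>k<N. u k \<in> carrier_vec (dim_col B)) \<and>
        x 0 = x0 \<and> x N = x1 \<and>
        (\<forall>k<N. x (Suc k) = A *\<^sub>v x k + B *\<^sub>v u k))"

definition data_matrix :: "nat \<Rightarrow> (nat \<Rightarrow> real vec) \<Rightarrow> nat \<Rightarrow> nat \<Rightarrow> real mat" where
  "data_matrix d z i T = mat_of_cols d (map (\<lambda>k. z (i + k)) [0..<T])"

text \<open>
  Meaningful only for \<open>S\<close> of full row rank: then \<open>S * S\<^sup>T\<close> is invertible, and \<open>mat_inverse\<close> returns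
  \<open>Some\<close> of its inverse.
\<close>

definition right_pinv :: "real mat \<Rightarrow> real mat" where
  "right_pinv S = transpose_mat S * the (mat_inverse (S * transpose_mat S))"

end

theory Submission
  imports Defs
begin

text \<open>
  The dynamics say \<open>X\<^sub>1 = A X\<^sub>0 + B U\<^sub>0\<close>. Given \<open>u\<close> and \<open>x\<close>, the vector \<open>w = S\<^sup>\<dagger> (u, x)\<close>, with \<open>S\<close> the
  stacked data matrix, satisfies \<open>S w = (u, x)\<close>, that is \<open>U\<^sub>0 w = u\<close> and \<open>X\<^sub>0 w = x\<close>; hence
  \<open>X\<^sub>1 w = A x + B u\<close>.
\<close>

text \<open>A maximal independent set of columns has \<open>rank S = n\<close> elements, so it is a
  basis of the whole space. Every \<open>y\<close> is therefore a combination of columns of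
  \<open>S\<close>, and the coefficients form the preimage \<open>w\<close>.\<close>

lemma (in vec_space) full_row_rank_surj:
  assumes S: "S \<in> carrier_mat n nc" and rank: "rank S = n" and y: "y \<in> carrier_vec n"
  obtains w where "w \<in> carrier_vec nc" "S *\<^sub>v w = y"
proof -
  have cols: "set (cols S) \<subseteq> carrier_vec n"
    using S cols_dim by blast
  obtain U where "maximal U (\<lambda>T. T \<subseteq> set (cols S) \<and> lin_indpt T)"
    using maximal_exists_superset[of "set (cols S)" "\<lambda>T. T \<subseteq> set (cols S) \<and> lin_indpt T" "{}"]
      finite_lin_indpt2[of "{}"] by auto
  then have U: "U \<subseteq> set (cols S)" "lin_indpt U" "card U = n"
    using rank_card_indpt[OF S] rank unfolding maximal_def by auto
  have "finite U"
    using U(1) finite_subset by blast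
  then have "basis U"
    using dim_li_is_basis[of U] U cols fin_dim dim_is_n by auto
  then have "y \<in> span U"
    using y unfolding basis_def by auto
  then have "y \<in> col_space S"
    using span_is_monotone[OF U(1)] unfolding col_space_def by auto
  then show thesis
    using that S unfolding col_space_eq[OF S] by auto
qed

text \<open>The Gram matrix of the rows has trivial kernel, hence nonzero determinant. This is what
  gives the \<open>the\<close> in \<open>right_pinv\<close> a genuine value.\<close>

lemma gram_mat_inverse:
  fixes S :: "real mat"
  assumes S: "S \<in> carrier_mat d nc" and rank: "vec_space.rank d S = d"
  obtains R where "mat_inverse (S * S\<^sup>T) = Some R" "R \<in> carrier_mat d d" "(S * S\<^sup>T) * R = 1\<^sub>m d"
proof -
  interpret vec_space "TYPE(real)" d .
  have G: "S * S\<^sup>T \<in> carrier_mat d d"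
    using S by simp
  have inj: "v = 0\<^sub>v d" if v: "v \<in> carrier_vec d" and "(S * S\<^sup>T) *\<^sub>v v = 0\<^sub>v d" for v
  proof -
    have t: "S\<^sup>T *\<^sub>v v \<in> carrier_vec nc"
      using S v by simp
    have "S *\<^sub>v (S\<^sup>T *\<^sub>v v) = 0\<^sub>v d"
      using that S by (simp add: assoc_mult_mat_vec[of _ d nc _ d])
    \<comment> \<open>Moving one transpose across the scalar product turns the squared norm of
      \<open>S\<^sup>T *\<^sub>v v\<close> into the product of \<open>v\<close> with
      \<open>S *\<^sub>v (S\<^sup>T *\<^sub>v v)\<close>, which is zero.\<close>
    then have "(S\<^sup>T *\<^sub>v v) \<bullet> (S\<^sup>T *\<^sub>v v) = 0"
      using transpose_vec_mult_scalar[OF S t v] v by simp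
    then have t0: "S\<^sup>T *\<^sub>v v = 0\<^sub>v nc"
      using conjugate_square_eq_0_vec[OF t] by simp
    \<comment> \<open>The kernel of \<open>S\<^sup>T\<close> is orthogonal to the image of
      \<open>S\<close>. Since \<open>S\<close> is onto, \<open>v\<close> itself lies in that image
      and is thus orthogonal to itself.\<close>
    obtain w where w: "w \<in> carrier_vec nc" "S *\<^sub>v w = v"
      using full_row_rank_surj[OF S rank v] .
    have "v \<bullet> v = 0"
      using transpose_vec_mult_scalar[OF S w(1) v] w t0 by simp
    then show ?thesis
      using conjugate_square_eq_0_vec[OF v] by simp
  qed
  have "det (S * S\<^sup>T) \<noteq> 0"
    using inj det_0_iff_vec_prod_zero_field[OF G] by blast
  then have "S * S\<^sup>T \<in> Units (ring_mat TYPE(real) d ())"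
    by (rule det_non_zero_imp_unit[OF G])
  \<comment> \<open>The result \<open>None\<close> would mean that the Gram matrix is not a unit of
    the matrix ring; \<open>()\<close> only fills a dummy parameter of that ring.\<close>
  then obtain R where R: "mat_inverse (S * S\<^sup>T) = Some R"
    using mat_inverse(1)[OF G, of "()"] by (cases "mat_inverse (S * S\<^sup>T)") auto
  show thesis
    using that[OF R] mat_inverse(2)[OF G R] by simp
qed

text \<open>Reassociating \<open>S * (S\<^sup>T * R)\<close> as \<open>(S * S\<^sup>T) * R\<close>
  reduces the claim to the inverse of the Gram matrix.\<close>

lemma right_pinv:
  assumes S: "S \<in> carrier_mat d nc" and rank: "vec_space.rank d S = d"
  shows "right_pinv S \<in> carrier_mat nc d" "S * right_pinv S = 1\<^sub>m d"
proof -
  obtain R where R: "mat_inverse (S * S\<^sup>T) = Some R" "R \<in> carrier_mat d d" "(S * S\<^sup>T) * R = 1\<^sub>m d"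
    using gram_mat_inverse[OF assms] .
  show "right_pinv S \<in> carrier_mat nc d"
    using S R unfolding right_pinv_def by simp
  show "S * right_pinv S = 1\<^sub>m d"
    using assoc_mult_mat[OF S _ R(2), of "S\<^sup>T"] S R unfolding right_pinv_def by simp
qed

lemma data_matrix_carrier [simp]: "data_matrix d z i T \<in> carrier_mat d T"
  unfolding data_matrix_def using mat_of_cols_carrier(1)[of d "map (\<lambda>k. z (i + k)) [0..<T]"] by simp

lemma col_data_matrix:
  assumes "k < T" "z (i + k) \<in> carrier_vec d"
  shows "col (data_matrix d z i T) k = z (i + k)"
  unfolding data_matrix_def using assms by (subst col_mat_of_cols) auto

text \<open>Multiplication from the left acts column by column, so column \<open>k\<close> of the
  matrix equation is the recursion at time \<open>k\<close>.\<close>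

lemma data_matrix_dynamics:
  assumes A: "A \<in> carrier_mat n n" and B: "B \<in> carrier_mat n m"
    and u: "\<And>k. k < T \<Longrightarrow> u k \<in> carrier_vec m"
    and x: "\<And>k. k \<le> T \<Longrightarrow> x k \<in> carrier_vec n"
    and dynamics: "\<And>k. k < T \<Longrightarrow> x (k + 1) = A *\<^sub>v x k + B *\<^sub>v u k"
  shows "data_matrix n x 1 T = A * data_matrix n x 0 T + B * data_matrix m u 0 T"
    (is "?X1 = A * ?X + B * ?U")
proof (rule mat_col_eqI)
  have X: "?X \<in> carrier_mat n T" and U: "?U \<in> carrier_mat m T" and X1: "?X1 \<in> carrier_mat n T"
    by simp_all
  note AX = mult_carrier_mat[OF A X] and BU = mult_carrier_mat[OF B U]
  show "dim_row ?X1 = dim_row (A * ?X + B * ?U)" "dim_col ?X1 = dim_col (A * ?X + B * ?U)"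
    using X1 BU B unfolding carrier_mat_def by auto
  fix k
  assume "k < dim_col (A * ?X + B * ?U)"
  then have k: "k < T"
    using U by simp
  have "col (A * ?X + B * ?U) k = col (A * ?X) k + col (B * ?U) k"
    using AX BU k by (intro eq_vecI) auto
  also have "\<dots> = A *\<^sub>v x k + B *\<^sub>v u k"
    using col_mult2[OF A X k] col_mult2[OF B U k] col_data_matrix[of k T x 0 n]
      col_data_matrix[of k T u 0 m] u x k by simp
  \<comment> \<open>Offset 1 makes column \<open>k\<close> the state at \<open>k + 1\<close>; the
    last column is \<open>x T\<close>, which is why the states are given up to and including
    \<open>T\<close>.\<close>
  also have "\<dots> = col ?X1 k"
    using dynamics[OF k] col_data_matrix[of k T x 1 n] x[of "k + 1"] k by simp
  finally show "col ?X1 k = col (A * ?X + B * ?U) k" ..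
qed

theorem theorem1:
  fixes A B :: "real mat" and n m T :: nat
    and u\<^sub>d x\<^sub>d :: "nat \<Rightarrow> real vec"
  assumes A: "A \<in> carrier_mat n n"
    and B: "B \<in> carrier_mat n m"
    and controllable: "controllable A B"
    and u\<^sub>d: "\<And>k. k < T \<Longrightarrow> u\<^sub>d k \<in> carrier_vec m"
    and x\<^sub>d: "\<And>k. k \<le> T \<Longrightarrow> x\<^sub>d k \<in> carrier_vec n"
    and dynamics: "\<And>k. k < T \<Longrightarrow> x\<^sub>d (k + 1) = A *\<^sub>v x\<^sub>d k + B *\<^sub>v u\<^sub>d k"
    and rank: "vec_space.rank (m + n) (data_matrix m u\<^sub>d 0 T @\<^sub>r data_matrix n x\<^sub>d 0 T) = n + m"
  shows "\<forall>u \<in> carrier_vec m. \<forall>x \<in> carrier_vec n.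
    A *\<^sub>v x + B *\<^sub>v u =
      (data_matrix n x\<^sub>d 1 T * right_pinv (data_matrix m u\<^sub>d 0 T @\<^sub>r data_matrix n x\<^sub>d 0 T))
        *\<^sub>v (u @\<^sub>v x)"
proof (intro ballI)
  fix u x :: "real vec"
  assume u: "u \<in> carrier_vec m" and x: "x \<in> carrier_vec n"
  let ?U = "data_matrix m u\<^sub>d 0 T" and ?X = "data_matrix n x\<^sub>d 0 T" and ?X1 = "data_matrix n x\<^sub>d 1 T"
  let ?S = "?U @\<^sub>r ?X"
  have U: "?U \<in> carrier_mat m T" and X: "?X \<in> carrier_mat n T" and X1: "?X1 \<in> carrier_mat n T"
    by simp_all
  have S: "?S \<in> carrier_mat (m + n) T"
    using U X by (rule carrier_append_rows)
  have P: "right_pinv ?S \<in> carrier_mat T (m + n)" "?S * right_pinv ?S = 1\<^sub>m (m + n)"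
    using right_pinv[OF S] rank by (simp_all add: add.commute)
  have ux: "u @\<^sub>v x \<in> carrier_vec (m + n)"
    using u x by simp
  define w where "w = right_pinv ?S *\<^sub>v (u @\<^sub>v x)"
  have w: "w \<in> carrier_vec T"
    unfolding w_def using P(1) ux by simp
  have "(?U *\<^sub>v w) @\<^sub>v (?X *\<^sub>v w) = ?S *\<^sub>v w"
    using mat_mult_append[OF U X w] by simp
  also have "\<dots> = u @\<^sub>v x"
    unfolding w_def using assoc_mult_mat_vec[OF S P(1) ux] P(2) ux by simp
  \<comment> \<open>The upper blocks on both sides have dimension \<open>m\<close>, so the equality
    of stacked vectors splits into its two blocks.\<close>
  finally have Uw: "?U *\<^sub>v w = u" and Xw: "?X *\<^sub>v w = x"
    using append_vec_eq[of "?U *\<^sub>v w" m u] U w u by auto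
  have X1_eq: "?X1 = A * ?X + B * ?U"
    using A B u\<^sub>d x\<^sub>d dynamics by (rule data_matrix_dynamics)
  have "(?X1 * right_pinv ?S) *\<^sub>v (u @\<^sub>v x) = ?X1 *\<^sub>v w"
    unfolding w_def by (rule assoc_mult_mat_vec[OF X1 P(1) ux])
  \<comment> \<open>The recorded transitions are combined with the weights \<open>w\<close>: by
    linearity the combined successor states come from the combined states \<open>x\<close> and
    inputs \<open>u\<close>.\<close>
  also have "\<dots> = (A * ?X) *\<^sub>v w + (B * ?U) *\<^sub>v w"
    unfolding X1_eq
    by (rule add_mult_distrib_mat_vec[OF mult_carrier_mat[OF A X] mult_carrier_mat[OF B U] w])
  also have "\<dots> = A *\<^sub>v x + B *\<^sub>v u"
    using assoc_mult_mat_vec[OF A X w] assoc_mult_mat_vec[OF B U w] Uw Xw by simp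
  finally show "A *\<^sub>v x + B *\<^sub>v u = (?X1 * right_pinv ?S) *\<^sub>v (u @\<^sub>v x)" ..
qed

end
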